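(* Let $A\in\mathbb{R}^{n\times n}$, $C\in\mathbb{R}^{m\times n}$, $Q\in\mathbb{S}^n_{++}$, $R\in\mathbb{S}^m_{++}$, $\Sigma\in\mathbb{S}^n_{++}$, and let $\varepsilon>0$ and a sufficiently small $\delta>0$ be fixed. The optimization problem $$\sup_{\bar Q,\bar R,\bar\Sigma}\ F(\bar Q,\bar R,\bar\Sigma)\quad\text{subject to}\quad w(\bar Q,\bar R,\bar\Sigma)\le\varepsilon,\ \ \bar Q\succeq0,\ \ \bar R\succeq\delta I_m,\ \ \bar\Sigma\succeq0,$$ over $(\bar Q,\bar R,\bar\Sigma)\in\mathbb{S}^n\times\mathbb{S}^m\times\mathbb{S}^n$, is convex; that is, on the convex set $\{\bar Q\succeq0,\ \bar R\succeq\delta I_m,\ \bar\Sigma\succeq0\}$ the objective $F$ (to be maximized) is concave and the constraint function $w$ is convex.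
   Context: Notation: $\mathbb{S}^n$ is the space of symmetric $n\times n$ real matrices; $\mathbb{S}^n_+$, $\mathbb{S}^n_{++}$ are the positive semi-definite and positive definite ones; $X\succeq Y$ means $X-Y\in\mathbb{S}^n_+$; $\sqrt X$ is the positive semi-definite square root of $X\in\mathbb{S}^n_+$; $I_n$ is the identity. Define $$K := C A\bar\Sigma A^\top C^\top + C\bar Q C^\top+\bar R,\qquad M := C A\bar\Sigma A^\top + C\bar Q,$$ $$F(\bar Q,\bar R,\bar\Sigma) := \mathrm{tr}[A\bar\Sigma A^\top+\bar Q]-\mathrm{tr}[M M^\top K^{-1}].$$ Put $H:=I_n+A^\top A+A^\top C^\top CA$ and, for $X\in\mathbb{S}^n_+$, $Y\in\mathbb{S}^m_+$, $\sigma^2(X,Y):=\begin{pmatrix}X & XC^\top\\ CX & CXC^\top+Y\end{pmatrix}$, and define $$w(\bar Q,\bar R,\bar\Sigma):=\mathrm{tr}\Big[\sigma^2(Q,R)+\sigma^2(\bar Q,\bar R)-2\sqrt{\sqrt{\sigma^2(Q,R)}\,\sigma^2(\bar Q,\bar R)\sqrt{\sigma^2(Q,R)}}\Big]+\mathrm{tr}\Big[H\Sigma+H\bar\Sigma-2\sqrt{\sqrt{\Sigma}\,H\bar\Sigma H\sqrt{\Sigma}}\Big].$$ *)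

theory Defs
  imports "HOL-Analysis.Analysis"
begin

definition psd :: "real^'n^'n \<Rightarrow> bool" where
  "psd X \<longleftrightarrow> transpose X = X \<and> (\<forall>v. 0 \<le> v \<bullet> (X *v v))"

definition pd :: "real^'n^'n \<Rightarrow> bool" where
  "pd X \<longleftrightarrow> transpose X = X \<and> (\<forall>v. v \<noteq> 0 \<longrightarrow> 0 < v \<bullet> (X *v v))"

definition loewner_ge :: "real^'n^'n \<Rightarrow> real^'n^'n \<Rightarrow> bool" (infix \<open>\<succeq>\<close> 50) where
  "X \<succeq> Y \<longleftrightarrow> psd (X - Y)"

(* Meaningful only if psd X; all uses below are at positive semidefinite
   arguments when the variables range over the domain of the problem. *)
definition msqrt :: "real^'n^'n \<Rightarrow> real^'n^'n" where
  "msqrt X = (THE S. psd S \<and> S ** S = X)"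

definition block_matrix ::
  "real^'n^'n \<Rightarrow> real^'m^'n \<Rightarrow> real^'n^'m \<Rightarrow> real^'m^'m \<Rightarrow> real^('n + 'm)^('n + 'm)" where
  "block_matrix X11 X12 X21 X22 = (\<chi> i j.
     case i of
       Inl a \<Rightarrow> (case j of Inl b \<Rightarrow> X11 $ a $ b | Inr b \<Rightarrow> X12 $ a $ b)
     | Inr a \<Rightarrow> (case j of Inl b \<Rightarrow> X21 $ a $ b | Inr b \<Rightarrow> X22 $ a $ b))"

definition sigma2 :: "real^'n^'m \<Rightarrow> real^'n^'n \<Rightarrow> real^'m^'m \<Rightarrow> real^('n + 'm)^('n + 'm)" where
  "sigma2 C X Y =
     block_matrix X (X ** transpose C) (C ** X) (C ** X ** transpose C + Y)"

definition K_mat ::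
  "real^'n^'n \<Rightarrow> real^'n^'m \<Rightarrow> real^'n^'n \<Rightarrow> real^'m^'m \<Rightarrow> real^'n^'n \<Rightarrow> real^'m^'m" where
  "K_mat A C Qb Rb Sb =
     C ** A ** Sb ** transpose A ** transpose C + C ** Qb ** transpose C + Rb"

definition M_mat ::
  "real^'n^'n \<Rightarrow> real^'n^'m \<Rightarrow> real^'n^'n \<Rightarrow> real^'n^'n \<Rightarrow> real^'n^'m" where
  "M_mat A C Qb Sb = C ** A ** Sb ** transpose A + C ** Qb"

definition F_obj ::
  "real^'n^'n \<Rightarrow> real^'n^'m \<Rightarrow> real^'n^'n \<Rightarrow> real^'m^'m \<Rightarrow> real^'n^'n \<Rightarrow> real" where
  "F_obj A C Qb Rb Sb =
     trace (A ** Sb ** transpose A + Qb)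
     - trace (M_mat A C Qb Sb ** transpose (M_mat A C Qb Sb)
              ** matrix_inv (K_mat A C Qb Rb Sb))"

definition H_mat :: "real^'n^'n \<Rightarrow> real^'n^'m \<Rightarrow> real^'n^'n" where
  "H_mat A C = mat 1 + transpose A ** A + transpose A ** transpose C ** C ** A"

definition w_constr ::
  "real^'n^'n \<Rightarrow> real^'n^'m \<Rightarrow> real^'n^'n \<Rightarrow> real^'m^'m \<Rightarrow> real^'n^'n
   \<Rightarrow> real^'n^'n \<Rightarrow> real^'m^'m \<Rightarrow> real^'n^'n \<Rightarrow> real" where
  "w_constr A C Q R S Qb Rb Sb =
     trace (sigma2 C Q R + sigma2 C Qb Rb
            - 2 *\<^sub>R msqrt (msqrt (sigma2 C Q R) ** sigma2 C Qb Rb ** msqrt (sigma2 C Q R)))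
     + trace (H_mat A C ** S + H_mat A C ** Sb
            - 2 *\<^sub>R msqrt (msqrt S ** H_mat A C ** Sb ** H_mat A C ** msqrt S))"

(* Symmetry of the three variables is part of psd; for Rb it follows from
   symmetry of Rb - \<delta> I. *)
definition dom_set ::
  "real \<Rightarrow> ((real^'n^'n) \<times> (real^'m^'m) \<times> (real^'n^'n)) set" where
  "dom_set \<delta> = {(Qb, Rb, Sb). Qb \<succeq> 0 \<and> Rb \<succeq> \<delta> *\<^sub>R mat 1 \<and> Sb \<succeq> 0}"

definition feasible_set ::
  "real^'n^'n \<Rightarrow> real^'n^'m \<Rightarrow> real^'n^'n \<Rightarrow> real^'m^'m \<Rightarrow> real^'n^'n \<Rightarrow> real \<Rightarrow> real
   \<Rightarrow> ((real^'n^'n) \<times> (real^'m^'m) \<times> (real^'n^'n)) set" where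
  "feasible_set A C Q R S \<epsilon> \<delta> =
     {(Qb, Rb, Sb) \<in> dom_set \<delta>. w_constr A C Q R S Qb Rb Sb \<le> \<epsilon>}"

end

theory Submission
  imports Defs
begin

text \<open>
  Everything that depends on the three variables inside \<open>F\<close> and \<open>w\<close> is linear, except for the
  term \<open>tr[M M\<^sup>T K\<^sup>-\<^sup>1]\<close> of \<open>F\<close> and the two square roots of \<open>w\<close>.

  The first is the sum over the columns \<open>m\<close> of \<open>M\<close> of the matrix fractional function
  \<open>m \<bullet> K\<^sup>-\<^sup>1 m\<close>. For positive definite \<open>K\<close> this is the maximum over \<open>v\<close> of
  \<open>2 (v \<bullet> m) - v \<bullet> K v\<close> (\<open>matrix_fractional_ge\<close>), hence jointly convex in \<open>(K, m)\<close>
  (\<open>matrix_fractional_convex\<close>); and \<open>K\<close> and \<open>M\<close> are linear in the variables, with \<open>K\<close> positive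
  definite because \<open>Rb \<succeq> \<delta> I\<close> with \<open>\<delta> > 0\<close>.

  The matrices under the outer square roots have the form \<open>L X L\<^sup>T\<close> with \<open>L\<close> constant and \<open>X\<close>
  positive semidefinite and linear in the variables. So convexity of \<open>w\<close> follows from concavity of
  the trace of the square root (\<open>trace_msqrt_concave\<close>). In fact the square root is operator concave
  (\<open>msqrt_concave\<close>): for \<open>u + v = 1\<close> one has
  \<open>u S\<^sup>2 + v T\<^sup>2 - (u S + v T)\<^sup>2 = u v (S - T)\<^sup>2 \<succeq> 0\<close>,
  and the square root is monotone for the Loewner order (\<open>psd_sqrt_mono\<close>). Monotonicity comes from
  an eigenvector for the smallest eigenvalue of \<open>S - T\<close>; it also gives uniqueness of the square
  root, which, with existence (\<open>psd_sqrt_exists\<close>), is what the definite description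
  in the definition of \<open>msqrt\<close> needs.
\<close>

section \<open>Positive semidefinite matrices\<close>

lemma matrix_vector_mult_scaleR_left: "(k *\<^sub>R A) *v x = k *\<^sub>R (A *v x)"
  for A :: "real^'n^'m"
  by (simp add: scaleR_matrix_vector_assoc)

text \<open>
  Matrix identities are verified below by applying both sides to a vector and expanding with these
  rules, which push the action of a compound matrix down to its constituents.
\<close>

lemmas matvec_simps =
  matrix_vector_mul_assoc[symmetric] matrix_vector_mult_add_rdistrib
  matrix_vector_mult_diff_rdistrib matrix_vector_right_distrib
  matrix_vector_mult_diff_distrib matrix_vector_mult_scaleR
  matrix_vector_mult_scaleR_left

lemma inner_transpose: "x \<bullet> (transpose A *v y) = (A *v x) \<bullet> y" for A :: "real^'n^'m"
  by (metis dot_lmul_matrix inner_commute transpose_matrix_vector)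

lemma inner_symmetric:
  fixes A :: "real^'n^'n"
  assumes "transpose A = A"
  shows "x \<bullet> (A *v y) = (A *v x) \<bullet> y"
  using inner_transpose[of x A y] assms by simp

lemma symmetricI:
  fixes A :: "real^'n^'n"
  assumes "\<And>x y. x \<bullet> (A *v y) = (A *v x) \<bullet> y"
  shows "transpose A = A"
  by (metis assms inner_transpose matrix_eq vector_eq_rdot inner_commute)

lemma psdI:
  assumes "\<And>x y. x \<bullet> (A *v y) = (A *v x) \<bullet> y" "\<And>v. 0 \<le> v \<bullet> (A *v v)"
  shows "psd A"
  using assms by (simp add: psd_def symmetricI)

lemma psd_inner_commute: "psd A \<Longrightarrow> x \<bullet> (A *v y) = (A *v x) \<bullet> y"
  by (simp add: psd_def inner_symmetric)

lemma psd_nonneg: "psd A \<Longrightarrow> 0 \<le> v \<bullet> (A *v v)"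
  by (simp add: psd_def)

lemma pd_imp_psd: "pd A \<Longrightarrow> psd A"
  unfolding pd_def psd_def by (metis inner_zero_left less_eq_real_def)

lemma psd_add:
  assumes "psd A" "psd B"
  shows "psd (A + B)"
proof (rule psdI)
  show "x \<bullet> ((A + B) *v y) = ((A + B) *v x) \<bullet> y" for x y
    using assms by (simp add: matvec_simps inner_add psd_inner_commute)
  show "0 \<le> v \<bullet> ((A + B) *v v)" for v
    using assms by (simp add: matvec_simps inner_add psd_nonneg)
qed

lemma psd_scaleR:
  assumes "psd A" "0 \<le> c"
  shows "psd (c *\<^sub>R A)"
proof (rule psdI)
  show "x \<bullet> ((c *\<^sub>R A) *v y) = ((c *\<^sub>R A) *v x) \<bullet> y" for x y
    using assms by (simp add: matvec_simps psd_inner_commute)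
  show "0 \<le> v \<bullet> ((c *\<^sub>R A) *v v)" for v
    using assms by (simp add: matvec_simps psd_nonneg)
qed

lemma pd_psd_add:
  assumes "psd A" "pd B"
  shows "pd (A + B)"
proof -
  have "transpose (A + B) = A + B"
    using psd_add[OF assms(1) pd_imp_psd[OF assms(2)]] by (simp add: psd_def)
  moreover have "0 < v \<bullet> ((A + B) *v v)" if "v \<noteq> 0" for v
    using assms that psd_nonneg[OF assms(1), of v] 
    by (simp add: pd_def matvec_simps inner_add add_nonneg_pos)
  ultimately show ?thesis by (simp add: pd_def)
qed

lemma psd_congruence:
  fixes L :: "real^'n^'m"
  assumes "psd X"
  shows "psd (L ** X ** transpose L)"
proof (rule psdI)
  show "x \<bullet> ((L ** X ** transpose L) *v y) = ((L ** X ** transpose L) *v x) \<bullet> y" for x y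
  proof -
    have "x \<bullet> (L *v (X *v (transpose L *v y))) = (transpose L *v x) \<bullet> (X *v (transpose L *v y))"
      by (metis inner_transpose transpose_transpose)
    also have "\<dots> = (L *v (X *v (transpose L *v x))) \<bullet> y"
      by (metis inner_transpose psd_inner_commute assms)
    finally show ?thesis by (simp only: matvec_simps)
  qed
  show "0 \<le> v \<bullet> ((L ** X ** transpose L) *v v)" for v
  proof -
    have "v \<bullet> (L *v (X *v (transpose L *v v))) = (transpose L *v v) \<bullet> (X *v (transpose L *v v))"
      by (metis inner_transpose transpose_transpose)
    then show ?thesis using psd_nonneg[OF assms] by (simp only: matvec_simps)
  qed
qed

lemma psd_mat_1: "psd (mat 1)"
  by (simp add: psd_def)

lemma psd_mult_transpose: "psd (L ** transpose L)"
  using psd_congruence[OF psd_mat_1, of L] by simp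

lemma transpose_diff: "transpose (A - B) = transpose A - transpose B" for A B :: "real^'n^'m"
  by (simp add: transpose_def vec_eq_iff)

lemma trace_scaleR: "trace (c *\<^sub>R A) = c * trace A" for A :: "real^'n^'n"
  by (simp add: trace_def sum_distrib_left)

lemma trace_eq_sum_quadratic: 
  "trace A = (\<Sum>i\<in>UNIV. axis i 1 \<bullet> (A *v axis i 1))" for A :: "real^'n^'n"
  by (simp add: trace_def matrix_vector_mult_basis column_def inner_axis')

lemma psd_trace_nonneg: "psd A \<Longrightarrow> 0 \<le> trace A"
  by (simp add: trace_eq_sum_quadratic psd_nonneg sum_nonneg)

text \<open>
  If \<open>y = E x\<close> were nonzero, the form would be negative at \<open>x + t y\<close> for small negative \<open>t\<close>.
\<close>

lemma psd_isotropic_imp_kernel: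
  assumes psd: "psd E" and iso: "x \<bullet> (E *v x) = 0"
  shows "E *v x = 0"
proof (rule ccontr)
  define y where "y = E *v x"
  define b where "b = y \<bullet> (E *v y)"
  define t where "t = - (y \<bullet> y) / (b + 1)"
  assume "E *v x \<noteq> 0"
  then have y: "0 < y \<bullet> y" by (simp add: y_def)
  have b: "0 \<le> b" using psd_nonneg[OF psd] by (simp add: b_def)
  have xy: "x \<bullet> (E *v y) = y \<bullet> y"
    using psd_inner_commute[OF psd] by (simp add: y_def)
  have "0 \<le> (x + t *\<^sub>R y) \<bullet> (E *v (x + t *\<^sub>R y))"
    using psd by (rule psd_nonneg)
  also have "\<dots> = 2 * t * (y \<bullet> y) + t\<^sup>2 * b"
    using iso xy by (simp add: matvec_simps inner_add b_def y_def[symmetric] power2_eq_square algebra_simps)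
  also have "y \<bullet> y = - t * (b + 1)"
    using b by (simp add: t_def)
  also have "2 * t * (- t * (b + 1)) + t\<^sup>2 * b = - (t\<^sup>2 * (b + 2))"
    by (simp add: power2_eq_square algebra_simps)
  finally have "t = 0"
    using b by (simp add: mult_le_0_iff)
  then show False
    using y b by (simp add: t_def)
qed

text \<open>
  A minimizer of the quadratic form on the unit sphere is an eigenvector: subtracting the minimum \<open>l\<close>
  times the identity leaves a positive semidefinite form that is isotropic at the minimizer.
\<close>

lemma symmetric_min_eigenvector:
  fixes D :: "real^'n^'n"
  assumes sym: "transpose D = D"
  obtains x l where "x \<bullet> x = 1" "D *v x = l *\<^sub>R x" "\<And>v. l * (v \<bullet> v) \<le> v \<bullet> (D *v v)"
proof -
  have "continuous_on (sphere 0 1) (\<lambda>v. v \<bullet> (D *v v))"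
    by (intro continuous_intros matrix_vector_mult_linear_continuous_on)
  moreover have "sphere (0::real^'n) 1 \<noteq> {}" by simp
  ultimately obtain x where x: "x \<in> sphere 0 1"
    and min: "\<And>v. v \<in> sphere 0 1 \<Longrightarrow> x \<bullet> (D *v x) \<le> v \<bullet> (D *v v)"
    using continuous_attains_inf[OF compact_sphere, of "0::real^'n" 1 "\<lambda>v. v \<bullet> (D *v v)"] by blast
  define l where "l = x \<bullet> (D *v x)"
  have xx: "x \<bullet> x = 1" using x by (simp add: norm_eq_1)
  have le: "l * (v \<bullet> v) \<le> v \<bullet> (D *v v)" for v
  proof (cases "v = 0")
    case False
    define w where "w = v /\<^sub>R norm v"
    have "l \<le> w \<bullet> (D *v w)" unfolding l_def
      by (rule min) (simp add: w_def False)
    moreover have v: "norm v *\<^sub>R w = v" by (simp add: w_def False)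
    have "(norm v)\<^sup>2 * (w \<bullet> (D *v w)) = (norm v *\<^sub>R w) \<bullet> (D *v (norm v *\<^sub>R w))"
      by (simp add: matrix_vector_mult_scaleR power2_eq_square)
    then have "v \<bullet> (D *v v) = (norm v)\<^sup>2 * (w \<bullet> (D *v w))" by (simp only: v)
    ultimately show ?thesis
      by (simp add: power2_norm_eq_inner[symmetric] mult.commute mult_right_mono)
  qed simp
  have "psd (D - l *\<^sub>R mat 1)"
    using le inner_symmetric[OF sym]
    by (intro psdI) (auto simp: matvec_simps inner_diff)
  moreover have "x \<bullet> ((D - l *\<^sub>R mat 1) *v x) = 0"
    using xx by (simp add: matvec_simps inner_diff l_def)
  ultimately have "(D - l *\<^sub>R mat 1) *v x = 0" by (rule psd_isotropic_imp_kernel)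
  then have "D *v x = l *\<^sub>R x" by (simp add: matvec_simps)
  then show thesis using that xx le by blast
qed

section \<open>The positive semidefinite square root\<close>

text \<open>
  The induction is on the rank. Splitting off \<open>c x x\<^sup>T\<close>, where \<open>x\<close> is a unit eigenvector
  for the largest eigenvalue \<open>c > 0\<close>, leaves a positive semidefinite matrix whose kernel contains
  \<open>x\<close> in addition to the old kernel. Its square root \<open>T\<close> also annihilates \<open>x\<close>, so that
  \<open>T + sqrt c x x\<^sup>T\<close> is a square root of the original matrix.
\<close>

lemma psd_sqrt_exists:
  fixes Z :: "real^'n^'n"
  assumes "psd Z"
  shows "\<exists>S. psd S \<and> S ** S = Z"
  using assms
proof (induction "CARD('n) - dim {v. Z *v v = 0}" arbitrary: Z rule: less_induct)
  case less
  show ?case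
  proof (cases "Z = 0")
    case True
    then show ?thesis by (intro exI[of _ 0]) (simp add: psd_def matrix_matrix_mult_def transpose_def vec_eq_iff)
  next
    case False
    have sym: "transpose (- Z) = - Z"
      using less.prems by (simp add: psd_def transpose_def vec_eq_iff)
    obtain x l where xx: "x \<bullet> x = 1" and eig: "- Z *v x = l *\<^sub>R x"
      and max: "\<And>v. l * (v \<bullet> v) \<le> v \<bullet> (- Z *v v)"
      by (rule symmetric_min_eigenvector[OF sym]) blast
    have neg: "- Z *v v = - (Z *v v)" for v
      using matrix_vector_mult_diff_rdistrib[of 0 Z v] by simp
    define c where "c = - l"
    have Zx: "Z *v x = c *\<^sub>R x" using eig by (simp add: neg c_def) (metis minus_equation_iff)
    have up: "v \<bullet> (Z *v v) \<le> c * (v \<bullet> v)" for v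
      using max[of v] by (simp add: neg c_def)
    have "x \<bullet> (Z *v x) = c" using Zx xx by simp
    then have "0 \<le> c" using psd_nonneg[OF less.prems] by metis
    moreover have "c \<noteq> 0"
    proof
      assume "c = 0"
      then have "v \<bullet> (Z *v v) = 0" for v
        using up[of v] psd_nonneg[OF less.prems, of v] by simp
      then have "Z *v v = 0" for v using less.prems psd_isotropic_imp_kernel by blast
      then show False using False by (metis matrix_eq matrix_vector_mult_0)
    qed
    ultimately have c: "0 < c" by simp
    define P :: "real^'n^'n" where "P = (\<chi> i j. x $ i * x $ j)"
    have P: "P *v v = (x \<bullet> v) *\<^sub>R x" for v
      by (simp add: P_def matrix_vector_mult_def vec_eq_iff inner_vec_def sum_distrib_right 
          sum_distrib_left mult_ac)
    have psdP: "psd P" by (rule psdI) (simp_all add: P inner_commute)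
    define Y where "Y = Z - c *\<^sub>R P"
    have Y: "Y *v v = Z *v v - (c * (x \<bullet> v)) *\<^sub>R x" for v
      by (simp add: Y_def matvec_simps P)
    have psdY: "psd Y"
    proof (rule psdI)
      show "v \<bullet> (Y *v w) = (Y *v v) \<bullet> w" for v w
        using psd_inner_commute[OF less.prems, of v w] by (simp add: Y inner_diff inner_commute)
      show "0 \<le> v \<bullet> (Y *v v)" for v
      proof -
        define u where "u = v - (x \<bullet> v) *\<^sub>R x"
        have xu: "x \<bullet> u = 0" using xx by (simp add: u_def inner_diff)
        have "v = u + (x \<bullet> v) *\<^sub>R x" by (simp add: u_def)
        then have "Y *v v = Y *v u + (x \<bullet> v) *\<^sub>R (Y *v x)"
          by (metis matrix_vector_right_distrib matrix_vector_mult_scaleR)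
        also have "\<dots> = Z *v u" using xu xx by (simp add: Y Zx)
        finally have "v \<bullet> (Y *v v) = u \<bullet> (Z *v u) + (x \<bullet> v) * (x \<bullet> (Z *v u))"
          by (simp add: u_def inner_diff)
        also have "x \<bullet> (Z *v u) = 0"
          using psd_inner_commute[OF less.prems] xu by (simp add: Zx)
        finally show ?thesis using psd_nonneg[OF less.prems] by simp
      qed
    qed
    have Yx: "Y *v x = 0" using xx by (simp add: Y Zx)
    have ker: "{v. Z *v v = 0} \<subset> {v. Y *v v = 0}"
    proof (rule psubsetI)
      have "x \<bullet> v = 0" if "Z *v v = 0" for v
        using psd_inner_commute[OF less.prems, of x v] that c by (simp add: Zx)
      then show "{v. Z *v v = 0} \<subseteq> {v. Y *v v = 0}" by (auto simp: Y)
      have "Z *v x \<noteq> 0" using Zx c xx by auto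
      then show "{v. Z *v v = 0} \<noteq> {v. Y *v v = 0}" using Yx by blast
    qed
    have subsp: "subspace {v. B *v v = 0}" for B :: "real^'n^'n"
      by (simp add: subspace_def matvec_simps)
    have "dim {v. Z *v v = 0} < dim {v. Y *v v = 0}"
      by (rule dim_psubset) (simp only: span_eq_iff[THEN iffD2, OF subsp] ker)
    moreover have "dim {v. Y *v v = 0} \<le> CARD('n)" by (rule dim_subset_UNIV_cart)
    ultimately have "CARD('n) - dim {v. Y *v v = 0} < CARD('n) - dim {v. Z *v v = 0}"
      by linarith
    from less.hyps[OF this psdY] obtain T where T: "psd T" "T ** T = Y" by blast
    have "(T *v x) \<bullet> (T *v x) = x \<bullet> (Y *v x)"
      using psd_inner_commute[OF T(1)] T(2) by (metis matrix_vector_mul_assoc)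
    then have Tx: "T *v x = 0" using Yx by simp
    have xT: "x \<bullet> (T *v v) = 0" for v using psd_inner_commute[OF T(1)] Tx by simp
    have TT: "T *v (T *v v) = Y *v v" for v using T(2) by (simp add: matrix_vector_mul_assoc)
    have "psd (T + sqrt c *\<^sub>R P)" using T(1) psdP c by (intro psd_add psd_scaleR) auto
    moreover have "(T + sqrt c *\<^sub>R P) ** (T + sqrt c *\<^sub>R P) = Z"
      unfolding matrix_eq using c xx
      by (simp add: matvec_simps P Tx xT TT Y inner_add)
    ultimately show ?thesis by blast
  qed
qed

text \<open>
  If \<open>x\<close> is an eigenvector of \<open>S - T\<close> for the eigenvalue \<open>l\<close>, then
  \<open>x \<bullet> (S\<^sup>2 - T\<^sup>2) x = l (x \<bullet> S x + x \<bullet> T x)\<close>. When \<open>l < 0\<close> and the left side is nonnegative,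
  both forms vanish at \<open>x\<close>, and then so does \<open>l\<close>.
\<close>

lemma psd_sqrt_mono:
  fixes S T :: "real^'n^'n"
  assumes S: "psd S" and T: "psd T" and le: "psd (S ** S - T ** T)"
  shows "psd (S - T)"
proof -
  have "transpose (S - T) = S - T"
    by (rule symmetricI) (simp add: matvec_simps inner_diff psd_inner_commute[OF S] psd_inner_commute[OF T])
  then obtain x l where xx: "x \<bullet> x = 1" and eig: "(S - T) *v x = l *\<^sub>R x"
    and min: "\<And>v. l * (v \<bullet> v) \<le> v \<bullet> ((S - T) *v v)"
    using symmetric_min_eigenvector by blast
  have Sx: "S *v x = T *v x + l *\<^sub>R x" using eig by (simp add: matvec_simps algebra_simps)
  have "0 \<le> l"
  proof (rule ccontr)
    assume l: "\<not> 0 \<le> l"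
    have "0 \<le> x \<bullet> ((S ** S - T ** T) *v x)" using le by (rule psd_nonneg)
    also have "\<dots> = (S *v x) \<bullet> (S *v x) - (T *v x) \<bullet> (T *v x)"
      by (simp add: matvec_simps inner_diff psd_inner_commute[OF S] psd_inner_commute[OF T])
    also have "\<dots> = l * (x \<bullet> (S *v x) + x \<bullet> (T *v x))"
      by (simp add: Sx inner_add inner_commute algebra_simps)
    finally have "x \<bullet> (S *v x) + x \<bullet> (T *v x) \<le> 0"
      using l by (simp add: zero_le_mult_iff)
    then have "x \<bullet> (S *v x) = 0" "x \<bullet> (T *v x) = 0"
      using psd_nonneg[OF S, of x] psd_nonneg[OF T, of x] by auto
    then have "l = 0" using xx by (simp add: Sx inner_add)
    then show False using l by simp
  qed
  then have "0 \<le> v \<bullet> ((S - T) *v v)" for v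
    using min[of v] by (meson inner_ge_zero mult_nonneg_nonneg order_trans)
  then show ?thesis using \<open>transpose (S - T) = S - T\<close> by (simp add: psd_def)
qed

lemma psd_antisym:
  fixes D :: "real^'n^'n"
  assumes "psd D" "psd (- D)"
  shows "D = 0"
proof -
  have "- D *v v = - (D *v v)" for v
    using matrix_vector_mult_diff_rdistrib[of 0 D v] by simp
  then have "v \<bullet> (D *v v) = 0" for v
    using psd_nonneg[OF assms(1), of v] psd_nonneg[OF assms(2), of v] by simp
  then have "D *v v = 0" for v using assms(1) psd_isotropic_imp_kernel by blast
  then show ?thesis by (metis matrix_eq matrix_vector_mult_0)
qed

lemma psd_zero: "psd 0"
  by (rule psdI) simp_all

lemma psd_sqrt_unique:
  assumes "psd S" "psd T" "S ** S = T ** T"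
  shows "S = T"
  using psd_antisym[of "S - T"] psd_sqrt_mono[of S T] psd_sqrt_mono[of T S] assms
  by (simp add: psd_zero)

lemma msqrt:
  assumes "psd X"
  shows psd_msqrt: "psd (msqrt X)" and msqrt_square: "msqrt X ** msqrt X = X"
proof -
  have "\<exists>!S. psd S \<and> S ** S = X"
    using psd_sqrt_exists[OF assms] psd_sqrt_unique by metis
  then have "psd (msqrt X) \<and> msqrt X ** msqrt X = X"
    unfolding msqrt_def by (rule theI')
  then show "psd (msqrt X)" "msqrt X ** msqrt X = X" by auto
qed

lemma msqrt_concave:
  assumes X: "psd X" and Y: "psd Y" and uv: "0 \<le> u" "0 \<le> v" "u + v = 1"
  shows "psd (msqrt (u *\<^sub>R X + v *\<^sub>R Y) - (u *\<^sub>R msqrt X + v *\<^sub>R msqrt Y))"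
proof (rule psd_sqrt_mono)
  let ?Z = "u *\<^sub>R X + v *\<^sub>R Y" and ?B = "u *\<^sub>R msqrt X + v *\<^sub>R msqrt Y"
  let ?D = "msqrt X - msqrt Y"
  have Z: "psd ?Z" using assms by (intro psd_add psd_scaleR)
  show "psd (msqrt ?Z)" using Z by (rule psd_msqrt)
  show "psd ?B" using assms by (intro psd_add psd_scaleR psd_msqrt)
  have sq: "msqrt X *v (msqrt X *v w) = X *v w" "msqrt Y *v (msqrt Y *v w) = Y *v w" for w
    using msqrt_square[OF X] msqrt_square[OF Y] by (simp_all add: matrix_vector_mul_assoc)
  have v: "v = 1 - u" using uv by simp
  have "?Z - ?B ** ?B = (u * v) *\<^sub>R (?D ** ?D)"
    unfolding matrix_eq v by (simp add: matvec_simps sq algebra_simps)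
  moreover have "psd (?D ** ?D)"
    using psd_mult_transpose[of ?D] psd_msqrt[OF X] psd_msqrt[OF Y]
    by (simp add: psd_def transpose_diff)
  ultimately show "psd (msqrt ?Z ** msqrt ?Z - ?B ** ?B)"
    using uv by (simp add: msqrt_square[OF Z] psd_scaleR)
qed

lemma trace_msqrt_concave:
  assumes "psd X" "psd Y" "0 \<le> u" "0 \<le> v" "u + v = 1"
  shows "u * trace (msqrt X) + v * trace (msqrt Y) \<le> trace (msqrt (u *\<^sub>R X + v *\<^sub>R Y))"
  using psd_trace_nonneg[OF msqrt_concave[OF assms]]
  by (simp add: trace_sub trace_add trace_scaleR)

section \<open>The matrix fractional function\<close>

lemma pd_mult_matrix_inv:
  fixes K :: "real^'n^'n"
  assumes "pd K"
  shows "K *v (matrix_inv K *v m) = m"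
proof -
  have "\<forall>x. K *v x = 0 \<longrightarrow> x = 0" using assms by (metis inner_zero_right less_irrefl pd_def)
  then have "invertible K"
    using matrix_left_invertible_ker[of K] by (simp add: invertible_left_inverse)
  then have "K ** matrix_inv K = mat 1"
    unfolding invertible_def matrix_inv_def by (rule someI2_ex) simp
  then show ?thesis by (simp add: matrix_vector_mul_assoc)
qed

text \<open>
  Equality holds at \<open>v = matrix_inv K *v m\<close>; the difference of the two sides is a square in the
  form of \<open>K\<close>.
\<close>

lemma matrix_fractional_ge:
  assumes "pd K"
  shows "2 * (v \<bullet> m) - v \<bullet> (K *v v) \<le> m \<bullet> (matrix_inv K *v m)"
proof -
  define x where "x = matrix_inv K *v m"
  have Kx: "K *v x = m" using pd_mult_matrix_inv[OF assms] by (simp add: x_def)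
  have K: "psd K" using assms by (rule pd_imp_psd)
  have "0 \<le> (v - x) \<bullet> (K *v (v - x))" using K by (rule psd_nonneg)
  also have "\<dots> = v \<bullet> (K *v v) - 2 * (v \<bullet> m) + m \<bullet> x"
    by (simp add: matvec_simps inner_diff Kx psd_inner_commute[OF K, of x v] inner_commute)
  finally show ?thesis by (simp add: x_def)
qed

lemma matrix_fractional_convex:
  assumes K: "pd K" "pd L" "pd (u *\<^sub>R K + v *\<^sub>R L)" and uv: "0 \<le> u" "0 \<le> v"
  shows "(u *\<^sub>R k + v *\<^sub>R l) \<bullet> (matrix_inv (u *\<^sub>R K + v *\<^sub>R L) *v (u *\<^sub>R k + v *\<^sub>R l))
    \<le> u * (k \<bullet> (matrix_inv K *v k)) + v * (l \<bullet> (matrix_inv L *v l))"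
proof -
  let ?m = "u *\<^sub>R k + v *\<^sub>R l" and ?N = "u *\<^sub>R K + v *\<^sub>R L"
  \<comment> \<open>the maximizer for the combined pair is a competitor for each of the two given pairs\<close>
  define x where "x = matrix_inv ?N *v ?m"
  have "?m = ?N *v x" using pd_mult_matrix_inv[OF K(3)] by (simp add: x_def)
  then have "?m \<bullet> x = 2 * (x \<bullet> ?m) - x \<bullet> (?N *v x)" by (simp add: inner_commute)
  also have "\<dots> = u * (2 * (x \<bullet> k) - x \<bullet> (K *v x)) + v * (2 * (x \<bullet> l) - x \<bullet> (L *v x))"
    by (simp add: matvec_simps inner_add algebra_simps)
  also have "\<dots> \<le> u * (k \<bullet> (matrix_inv K *v k)) + v * (l \<bullet> (matrix_inv L *v l))"
    using uv K by (intro add_mono mult_left_mono matrix_fractional_ge)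
  finally show ?thesis by (simp add: x_def)
qed

lemma trace_fractional:
  fixes M :: "real^'n^'m"
  shows "trace (M ** transpose M ** N)
    = (\<Sum>i\<in>UNIV. (M *v axis i 1) \<bullet> (N *v (M *v axis i 1)))"
proof -
  have "trace (M ** transpose M ** N) = trace (transpose M ** N ** M)"
    by (metis matrix_mul_assoc trace_mul_sym)
  then show ?thesis
    by (simp only: trace_eq_sum_quadratic matvec_simps inner_transpose)
qed

section \<open>The covariance of state and observation\<close>

text \<open>
  If \<open>x\<close> is the state and \<open>y = C x + r\<close> the observation with noise \<open>r\<close>, then
  \<open>(x, y) = state_embedding C x + noise_embedding r\<close>; that is, these are the block columns
  \<open>(I, C)\<close> and \<open>(0, I)\<close>. They exhibit \<open>sigma2\<close> as a sum of two congruences, which makes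
  its linearity and its positive semidefiniteness evident.
\<close>

definition state_embedding :: "real^'n^'m \<Rightarrow> real^'n^('n + 'm)" where
  "state_embedding C = (\<chi> i. case i of Inl a \<Rightarrow> mat 1 $ a | Inr b \<Rightarrow> C $ b)"

text \<open>The block column \<open>(0, I)\<close>, which sends the noise to the observation.\<close>

definition noise_embedding :: "real^'m^('n::finite + 'm)" where
  "noise_embedding = (\<chi> i. case i of Inl a \<Rightarrow> 0 | Inr b \<Rightarrow> mat 1 $ b)"

lemma sigma2_eq:
  "sigma2 C X Y = state_embedding C ** X ** transpose (state_embedding C)
    + noise_embedding ** Y ** transpose noise_embedding"
proof -
  have one: "(if a = b then 1 else 0) * x = (if a = b then x else 0)"
    "x * (if a = b then 1 else 0) = (if a = b then x else 0)" for a b :: 'c and x :: real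
    by simp_all
  show ?thesis
    unfolding vec_eq_iff
  proof (intro allI)
    fix i j :: "'a + 'b"
    show "sigma2 C X Y $ i $ j = (state_embedding C ** X ** transpose (state_embedding C)
      + noise_embedding ** Y ** transpose noise_embedding) $ i $ j"
      by (cases i; cases j)
        (simp_all add: sigma2_def block_matrix_def state_embedding_def noise_embedding_def
          matrix_matrix_mult_def transpose_def mat_def one)
  qed
qed

lemma psd_sigma2:
  assumes "psd X" "psd Y"
  shows "psd (sigma2 C X Y)"
  unfolding sigma2_eq using assms by (intro psd_add psd_congruence)

lemma sigma2_affine:
  "sigma2 C (u *\<^sub>R X + v *\<^sub>R X') (u *\<^sub>R Y + v *\<^sub>R Y') = u *\<^sub>R sigma2 C X Y + v *\<^sub>R sigma2 C X' Y'"
  unfolding sigma2_eq matrix_eq by (simp add: matvec_simps algebra_simps)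

section \<open>Convexity of the problem\<close>

lemma mem_dom_set:
  "(Qb, Rb, Sb) \<in> dom_set \<delta> \<longleftrightarrow> psd Qb \<and> psd (Rb - \<delta> *\<^sub>R mat 1) \<and> psd Sb"
  by (simp add: dom_set_def loewner_ge_def)

lemma pd_scaled_identity: "0 < \<delta> \<Longrightarrow> pd (\<delta> *\<^sub>R mat 1 :: real^'n^'n)"
  by (simp add: pd_def transpose_scalar matvec_simps)

lemma dom_set_pd:
  assumes "(Qb, Rb, Sb) \<in> dom_set \<delta>" "0 < \<delta>"
  shows "pd Rb"
  using pd_psd_add[of "Rb - \<delta> *\<^sub>R mat 1" "\<delta> *\<^sub>R mat 1"] assms
  by (simp add: mem_dom_set pd_scaled_identity)

lemma convex_dom_set: "convex (dom_set \<delta> :: ((real^'n^'n) \<times> (real^'m^'m) \<times> (real^'n^'n)) set)"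
proof (rule convexI, clarify)
  fix Q1 Q2 S1 S2 :: "real^'n^'n" and R1 R2 :: "real^'m^'m" and u v :: real
  assume *: "(Q1, R1, S1) \<in> dom_set \<delta>" "(Q2, R2, S2) \<in> dom_set \<delta>" "0 \<le> u" "0 \<le> v" "u + v = 1"
  have "u *\<^sub>R (R1 - \<delta> *\<^sub>R mat 1) + v *\<^sub>R (R2 - \<delta> *\<^sub>R mat 1)
      = u *\<^sub>R R1 + v *\<^sub>R R2 - (u + v) *\<^sub>R (\<delta> *\<^sub>R mat 1)"
    by (simp only: scaleR_diff_right scaleR_left_distrib) simp
  then have "u *\<^sub>R R1 + v *\<^sub>R R2 - \<delta> *\<^sub>R mat 1
      = u *\<^sub>R (R1 - \<delta> *\<^sub>R mat 1) + v *\<^sub>R (R2 - \<delta> *\<^sub>R mat 1)"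
    using \<open>u + v = 1\<close> by simp
  then show "u *\<^sub>R (Q1, R1, S1) + v *\<^sub>R (Q2, R2, S2) \<in> dom_set \<delta>"
    using * by (simp add: mem_dom_set psd_add psd_scaleR)
qed

lemma pd_K_mat:
  assumes "(Qb, Rb, Sb) \<in> dom_set \<delta>" "0 < \<delta>"
  shows "pd (K_mat A C Qb Rb Sb)"
proof -
  have "psd ((C ** A) ** Sb ** transpose (C ** A) + C ** Qb ** transpose C)"
    using assms by (intro psd_add psd_congruence) (auto simp: mem_dom_set)
  from pd_psd_add[OF this dom_set_pd[OF assms]] show ?thesis
    by (simp add: K_mat_def matrix_transpose_mul matrix_mul_assoc)
qed

lemma K_mat_affine:
  "K_mat A C (u *\<^sub>R Q1 + v *\<^sub>R Q2) (u *\<^sub>R R1 + v *\<^sub>R R2) (u *\<^sub>R S1 + v *\<^sub>R S2)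
    = u *\<^sub>R K_mat A C Q1 R1 S1 + v *\<^sub>R K_mat A C Q2 R2 S2"
  unfolding K_mat_def matrix_eq by (simp add: matvec_simps algebra_simps)

lemma M_mat_affine:
  "M_mat A C (u *\<^sub>R Q1 + v *\<^sub>R Q2) (u *\<^sub>R S1 + v *\<^sub>R S2)
    = u *\<^sub>R M_mat A C Q1 S1 + v *\<^sub>R M_mat A C Q2 S2"
  unfolding M_mat_def matrix_eq by (simp add: matvec_simps algebra_simps)

lemma F_obj_concave:
  fixes A :: "real^'n^'n" and C :: "real^'n^'m"
  assumes "\<delta> > 0"
  shows "concave_on (dom_set \<delta>) (\<lambda>(Qb, Rb, Sb). F_obj A C Qb Rb Sb)"
  unfolding concave_on_iff
proof (intro conjI convex_dom_set ballI allI impI)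
  fix x y :: "(real^'n^'n) \<times> (real^'m^'m) \<times> (real^'n^'n)" and u v :: real
  assume xy: "x \<in> dom_set \<delta>" "y \<in> dom_set \<delta>" and uv: "0 \<le> u" "0 \<le> v" "u + v = 1"
  obtain Q1 R1 S1 where x: "x = (Q1, R1, S1)" by (cases x)
  obtain Q2 R2 S2 where y: "y = (Q2, R2, S2)" by (cases y)
  note 1 = xy(1)[unfolded x] and 2 = xy(2)[unfolded y]
  let ?q = "\<lambda>Q R S i. (M_mat A C Q S *v axis i 1) \<bullet>
    (matrix_inv (K_mat A C Q R S) *v (M_mat A C Q S *v axis i 1))"
  let ?Q = "u *\<^sub>R Q1 + v *\<^sub>R Q2" and ?R = "u *\<^sub>R R1 + v *\<^sub>R R2" and ?S = "u *\<^sub>R S1 + v *\<^sub>R S2"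
  have mem: "(?Q, ?R, ?S) \<in> dom_set \<delta>"
    using convexD[OF convex_dom_set 1 2 uv] by simp
  have F: "F_obj A C Q R S = trace (A ** S ** transpose A + Q) - (\<Sum>i\<in>UNIV. ?q Q R S i)" for Q R S
    by (simp add: F_obj_def trace_fractional)
  have "?q ?Q ?R ?S i \<le> u * ?q Q1 R1 S1 i + v * ?q Q2 R2 S2 i" for i
    using matrix_fractional_convex[OF pd_K_mat[OF 1 assms] pd_K_mat[OF 2 assms]
        pd_K_mat[OF mem assms, unfolded K_mat_affine] uv(1,2)]
    by (simp only: M_mat_affine K_mat_affine matvec_simps)
  then have "(\<Sum>i\<in>UNIV. ?q ?Q ?R ?S i) \<le> u * (\<Sum>i\<in>UNIV. ?q Q1 R1 S1 i) + v * (\<Sum>i\<in>UNIV. ?q Q2 R2 S2 i)"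
    by (simp only: sum_distrib_left sum.distrib[symmetric] sum_mono)
  moreover have "A ** ?S ** transpose A + ?Q
      = u *\<^sub>R (A ** S1 ** transpose A + Q1) + v *\<^sub>R (A ** S2 ** transpose A + Q2)"
    unfolding matrix_eq by (simp add: matvec_simps algebra_simps)
  then have "trace (A ** ?S ** transpose A + ?Q)
      = u * trace (A ** S1 ** transpose A + Q1) + v * trace (A ** S2 ** transpose A + Q2)"
    by (simp only: trace_add trace_scaleR)
  ultimately show "u * (case x of (Q, R, S) \<Rightarrow> F_obj A C Q R S) + v * (case y of (Q, R, S) \<Rightarrow> F_obj A C Q R S)
    \<le> (case u *\<^sub>R x + v *\<^sub>R y of (Q, R, S) \<Rightarrow> F_obj A C Q R S)"
    by (simp add: x y F right_diff_distrib)
qed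

lemma psd_H_mat: "psd (H_mat A C)"
proof -
  have "H_mat A C = mat 1 + transpose A ** A + transpose (C ** A) ** (C ** A)"
    by (simp add: H_mat_def matrix_transpose_mul matrix_mul_assoc)
  then show ?thesis
    using psd_mult_transpose[of "transpose A"] psd_mult_transpose[of "transpose (C ** A)"]
    by (simp add: psd_add psd_mat_1)
qed

lemma trace_msqrt_congruence_concave:
  assumes "psd X" "psd Y" "0 \<le> u" "0 \<le> v" "u + v = 1"
  shows "u * trace (msqrt (L ** X ** transpose L)) + v * trace (msqrt (L ** Y ** transpose L))
    \<le> trace (msqrt (L ** (u *\<^sub>R X + v *\<^sub>R Y) ** transpose L))"
proof -
  have "L ** (u *\<^sub>R X + v *\<^sub>R Y) ** transpose L
      = u *\<^sub>R (L ** X ** transpose L) + v *\<^sub>R (L ** Y ** transpose L)"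
    unfolding matrix_eq by (simp add: matvec_simps)
  then show ?thesis
    using trace_msqrt_concave[OF psd_congruence psd_congruence] assms by metis
qed

lemma w_constr_convex:
  fixes A Q S :: "real^'n^'n" and C :: "real^'n^'m" and R :: "real^'m^'m"
  assumes "psd Q" "psd R" "psd S" "\<delta> > 0"
  shows "convex_on (dom_set \<delta>) (\<lambda>(Qb, Rb, Sb). w_constr A C Q R S Qb Rb Sb)"
  unfolding convex_on_def
proof (intro conjI convex_dom_set ballI allI impI)
  fix x y :: "(real^'n^'n) \<times> (real^'m^'m) \<times> (real^'n^'n)" and u v :: real
  assume xy: "x \<in> dom_set \<delta>" "y \<in> dom_set \<delta>" and uv: "0 \<le> u" "0 \<le> v" "u + v = 1"
  obtain Q1 R1 S1 where x: "x = (Q1, R1, S1)" by (cases x)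
  obtain Q2 R2 S2 where y: "y = (Q2, R2, S2)" by (cases y)
  note 1 = xy(1)[unfolded x] and 2 = xy(2)[unfolded y]
  define H where "H = H_mat A C"
  define P where "P = msqrt (sigma2 C Q R)"
  \<comment> \<open>as \<open>H\<close> and \<open>msqrt S\<close> are symmetric, \<open>L ** Sb ** transpose L\<close> is the matrix under the second root\<close>
  define L where "L = msqrt S ** H"
  have HT: "transpose H = H"
    using psd_H_mat[of A C] by (simp add: H_def psd_def)
  have PT: "transpose P = P"
    using psd_msqrt[OF psd_sigma2[OF assms(1,2)]] by (simp add: P_def psd_def)
  have LT: "transpose L = H ** msqrt S"
    using psd_msqrt[OF assms(3)] by (simp add: L_def matrix_transpose_mul HT psd_def)
  have w: "w_constr A C Q R S Q' R' S'
    = trace (sigma2 C Q R) + trace (H ** S) + trace (sigma2 C Q' R') + trace (H ** S')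
      - 2 * trace (msqrt (P ** sigma2 C Q' R' ** transpose P))
      - 2 * trace (msqrt (L ** S' ** transpose L))" for Q' R' S'
    unfolding LT PT
    by (simp add: w_constr_def L_def P_def H_def trace_add trace_sub trace_scaleR matrix_mul_assoc)
  let ?Q = "u *\<^sub>R Q1 + v *\<^sub>R Q2" and ?R = "u *\<^sub>R R1 + v *\<^sub>R R2" and ?S = "u *\<^sub>R S1 + v *\<^sub>R S2"
  have psd12: "psd Q1" "psd Q2" "psd R1" "psd R2" "psd S1" "psd S2"
    using 1 2 dom_set_pd[OF 1 assms(4)] dom_set_pd[OF 2 assms(4)] by (auto simp: mem_dom_set pd_imp_psd)
  have "u * trace (msqrt (P ** sigma2 C Q1 R1 ** transpose P))
      + v * trace (msqrt (P ** sigma2 C Q2 R2 ** transpose P))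
    \<le> trace (msqrt (P ** sigma2 C ?Q ?R ** transpose P))"
    unfolding sigma2_affine using psd12 uv by (intro trace_msqrt_congruence_concave psd_sigma2)
  moreover have "u * trace (msqrt (L ** S1 ** transpose L)) + v * trace (msqrt (L ** S2 ** transpose L))
    \<le> trace (msqrt (L ** ?S ** transpose L))"
    using psd12 uv by (intro trace_msqrt_congruence_concave)
  moreover have "H ** ?S = u *\<^sub>R (H ** S1) + v *\<^sub>R (H ** S2)"
    unfolding matrix_eq by (simp add: matvec_simps)
  then have "trace (H ** ?S) = u * trace (H ** S1) + v * trace (H ** S2)"
    by (simp only: trace_add trace_scaleR)
  moreover have "trace (sigma2 C ?Q ?R) = u * trace (sigma2 C Q1 R1) + v * trace (sigma2 C Q2 R2)"
    by (simp only: sigma2_affine trace_add trace_scaleR)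
  moreover have "k = u * k + v * k" for k
    using uv(3) by (metis distrib_right mult_1)
  note this[of "trace (sigma2 C Q R) + trace (H ** S)"]
  ultimately have "w_constr A C Q R S ?Q ?R ?S
    \<le> u * w_constr A C Q R S Q1 R1 S1 + v * w_constr A C Q R S Q2 R2 S2"
    unfolding w ring_distribs by linarith
  then show "(case u *\<^sub>R x + v *\<^sub>R y of (Q', R', S') \<Rightarrow> w_constr A C Q R S Q' R' S')
    \<le> u * (case x of (Q', R', S') \<Rightarrow> w_constr A C Q R S Q' R' S')
      + v * (case y of (Q', R', S') \<Rightarrow> w_constr A C Q R S Q' R' S')"
    by (simp add: x y)
qed

theorem lemma3p2:
  fixes A Q S :: "real^'n^'n" and C :: "real^'n^'m" and R :: "real^'m^'m"
    and \<epsilon> \<delta> :: real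
  assumes "pd Q" and "pd R" and "pd S" and "\<epsilon> > 0" and "\<delta> > 0"
  shows "convex (dom_set \<delta> :: ((real^'n^'n) \<times> (real^'m^'m) \<times> (real^'n^'n)) set)
    \<and> concave_on (dom_set \<delta>) (\<lambda>(Qb, Rb, Sb). F_obj A C Qb Rb Sb)
    \<and> convex_on (dom_set \<delta>) (\<lambda>(Qb, Rb, Sb). w_constr A C Q R S Qb Rb Sb)
    \<and> convex (feasible_set A C Q R S \<epsilon> \<delta>)"
proof -
  let ?w = "\<lambda>(Qb, Rb, Sb). w_constr A C Q R S Qb Rb Sb"
  have w: "convex_on (dom_set \<delta>) ?w"
    using assms by (intro w_constr_convex pd_imp_psd)
  have feas: "feasible_set A C Q R S \<epsilon> \<delta> = {x \<in> dom_set \<delta>. ?w x \<le> \<epsilon>}"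
    by (auto simp: feasible_set_def)
  have "convex (feasible_set A C Q R S \<epsilon> \<delta>)"
    unfolding feas
  proof (rule convexI)
    fix x y :: "(real^'n^'n) \<times> (real^'m^'m) \<times> (real^'n^'n)" and u v :: real
    assume "x \<in> {x \<in> dom_set \<delta>. ?w x \<le> \<epsilon>}" "y \<in> {x \<in> dom_set \<delta>. ?w x \<le> \<epsilon>}"
      and uv: "0 \<le> u" "0 \<le> v" "u + v = 1"
    then have xy: "x \<in> dom_set \<delta>" "y \<in> dom_set \<delta>" "?w x \<le> \<epsilon>" "?w y \<le> \<epsilon>" by blast+
    have "?w (u *\<^sub>R x + v *\<^sub>R y) \<le> u * ?w x + v * ?w y"
      using w xy(1,2) uv unfolding convex_on_def by blast
    also have "\<dots> \<le> \<epsilon>" using xy(3,4) uv by (rule convex_bound_le)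
    finally show "u *\<^sub>R x + v *\<^sub>R y \<in> {x \<in> dom_set \<delta>. ?w x \<le> \<epsilon>}"
      using convexD[OF convex_dom_set xy(1,2) uv] by blast
  qed
  then show ?thesis using convex_dom_set F_obj_concave[OF \<open>\<delta> > 0\<close>] w by blast
qed

end
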